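(* Let $M$ be a smooth manifold of dimension $n$ and let $\mathcal M_{finite}$ be the set of all Riemannian metrics of finite volume on $M$. For $g\in\mathcal M_{finite}$, the Riemannian metric $$G_g(h,k)=\int_M \mathrm{trace}(g^{-1}hg^{-1}k)\,d\nu_g=\int_M\sum_{i=1}^n h\big(k(E_i)^\sharp,E_i\big)\,d\nu_g$$ is defined on the tangent space $T_g\mathcal M_{finite}=\Gamma_g$; that is, for all $h,k\in\Gamma_g$ the integral $G_g(h,k)$ is a well-defined (finite) real number.
   Context: $M$ is a smooth paracompact manifold with $\partial M=\emptyset$, not necessarily compact; $E=\mathcal S^2T^*M$ is the bundle of twice covariant symmetric tensors, and $\nu_g$ is the Riemannian volume measure of $g$; $g$ has finite volume if $\nu_g(M)<\infty$. $(E_i)_{i=1}^n$ denotes a local $g$-orthonormal frame field, and $\sharp:T^*M\to TM$ is the isomorphism induced by $g$. In $\mathrm{trace}(g^{-1}hg^{-1}k)$, elements of $\mathcal S^2T^*M$ are regarded as symmetric bundle maps $TM\to T^*M$. Cone fields. A cone field on a vector bundle is a map $x\mapsto K(x)\subset E_x$ such that each $K(x)$ is a closed convex cone with $K(x)\cap -K(x)=\{0\}$ and nonempty interior, and $\bigcup_x\mathrm{Int}(K(x))$ and $\bigcup_x(E_x\setminus K(x))$ are open in the total space. On $E=\mathcal S^2T^*M$, $K(x)$ is the cone of positive semidefinite forms (those $t\in E_x$ whose rank equals their positive inertia index); also a cone field $K_{TM}$ on $TM$ is fixed. Let $J^kE$ be the bundle of $k$-jets of sections, with $J^0E=E$, $j^0\sigma=\sigma$.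 Via the vector bundle isomorphism $J^kE\cong\bigoplus_{i=0}^k\mathcal L_s(TM^i,E)$ (symmetric $i$-linear maps; it comes from fixed connections on $TM$ and $E$), $K$ and $K_{TM}$ naturally induce a cone field $K^k$ on $J^kE$: $K^k(x)$ is the set of $(t_0,\dots,t_k)$ with $t_0\in K(x)$ and $t_i(v_1,\dots,v_i)\in K(x)$ for all $v_1,\dots,v_i\in K_{TM}(x)$, $1\le i\le k$; $K^0=K$. For sections $a,b$ of $J^iE$, $a\le b$ means $b(x)-a(x)\in K^i(x)$ for all $x\in M$. The space $\Gamma_g=\Gamma_g(\mathcal S^2T^*M)$ of indefinitely $g$-measurable sections is the set of smooth sections $\sigma$ of $\mathcal S^2T^*M$ such that for every $k\in\mathbb N=\{0,1,2,\dots\}$ there is $\lambda\ge 0$ with $-\lambda j^ig\le j^i\sigma\le\lambda j^ig$ for all $0\le i\le k$; in particular (case $k=0$) $-\lambda g\le\sigma\le\lambda g$ as quadratic forms at every point, for some $\lambda\ge0$. The set $\mathcal M_{finite}$ is regarded as an open submanifold of $\Gamma(\mathcal S^2T^*M)$, the space of smooth sections, with its manifold structure in which charts around $g$ are restrictions of the identity of the model space $\Gamma_g$; thus $T_g\mathcal M_{finite}$ is identified with $\Gamma_g$. *)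

theory Defs
  imports "HOL-Analysis.Analysis" "HOL-Library.Function_Algebras" "HOL-Combinatorics.Permutations"
begin

text \<open>Fibres of the bundles below are linear subspaces of function spaces, with pointwise
  operations.\<close>

instantiation "fun" :: (type, real_vector) real_vector
begin

definition scaleR_fun :: "real \<Rightarrow> ('a \<Rightarrow> 'b) \<Rightarrow> 'a \<Rightarrow> 'b" where
  "scaleR_fun a f = (\<lambda>x. a *\<^sub>R f x)"

instance
  by standard (simp_all add: scaleR_fun_def fun_eq_iff scaleR_add_right scaleR_add_left)

end

lemma scaleR_fun_apply [simp]: "(a *\<^sub>R f) x = a *\<^sub>R f x"
  by (simp add: scaleR_fun_def)


section \<open>Smooth manifolds\<close>

primrec Ck_on :: "nat \<Rightarrow> 'a::real_normed_vector set \<Rightarrow> ('a \<Rightarrow> 'b::real_normed_vector) \<Rightarrow> bool" where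
  "Ck_on 0 S f \<longleftrightarrow> continuous_on S f"
| "Ck_on (Suc r) S f \<longleftrightarrow>
     (\<forall>x\<in>S. f differentiable (at x)) \<and> (\<forall>v. Ck_on r S (\<lambda>x. frechet_derivative f (at x) v))"

text \<open>Only meaningful for open \<open>S\<close>.\<close>

definition smooth_on :: "'a::real_normed_vector set \<Rightarrow> ('a \<Rightarrow> 'b::real_normed_vector) \<Rightarrow> bool" where
  "smooth_on S f \<longleftrightarrow> (\<forall>r. Ck_on r S f)"

definition paracompact_space :: "'a topology \<Rightarrow> bool" where
  "paracompact_space M \<longleftrightarrow>
     (\<forall>\<U>. (\<forall>U\<in>\<U>. openin M U) \<and> \<Union>\<U> = topspace M \<longrightarrow>
       (\<exists>\<V>. (\<forall>V\<in>\<V>. openin M V \<and> (\<exists>U\<in>\<U>. V \<subseteq> U)) \<and> \<Union>\<V> = topspace M \<and> locally_finite_in M \<V>))"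

text \<open>A chart \<open>(U, \<phi>)\<close> is recorded with its domain; values of \<open>\<phi>\<close> outside \<open>U\<close> are irrelevant.\<close>

type_synonym ('a, 'n) chart = "'a set \<times> ('a \<Rightarrow> real ^ 'n)"

abbreviation chart_inv :: "('a, 'n) chart \<Rightarrow> real ^ 'n \<Rightarrow> 'a" where
  "chart_inv c \<equiv> inv_into (fst c) (snd c)"

definition is_chart :: "'a topology \<Rightarrow> ('a, 'n::finite) chart \<Rightarrow> bool" where
  "is_chart M c \<longleftrightarrow>
     openin M (fst c) \<and> open (snd c ` fst c) \<and>
     homeomorphic_map (subtopology M (fst c)) (top_of_set (snd c ` fst c)) (snd c)"

text \<open>The atlas is not required to be maximal: any smooth atlas determines the smooth structure.
  Up to canonical identifications, all notions below depend only on that structure.\<close>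

definition smooth_manifold :: "'a topology \<Rightarrow> ('a, 'n::finite) chart set \<Rightarrow> bool" where
  "smooth_manifold M A \<longleftrightarrow>
     Hausdorff_space M \<and> paracompact_space M \<and>
     (\<forall>c\<in>A. is_chart M c) \<and> \<Union>(fst ` A) = topspace M \<and>
     (\<forall>c\<in>A. \<forall>d\<in>A. smooth_on (snd c ` (fst c \<inter> fst d)) (snd d \<circ> chart_inv c))"

definition chart_at :: "('a, 'n) chart set \<Rightarrow> 'a \<Rightarrow> ('a, 'n) chart" where
  "chart_at A x = (SOME c. c \<in> A \<and> x \<in> fst c)"

definition smooth_functions :: "('a, 'n::finite) chart set \<Rightarrow> ('a \<Rightarrow> real) set" where
  "smooth_functions A = {f. \<forall>c\<in>A. smooth_on (snd c ` fst c) (f \<circ> chart_inv c)}"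


section \<open>Tangent bundle\<close>

text \<open>A tangent vector at \<open>x\<close> assigns to each chart around \<open>x\<close> its coordinate vector in that chart,
  subject to the transformation law; equivalently, it is a class of pairs (chart, coordinate
  vector). At charts not containing \<open>x\<close> the value is fixed to be \<open>0\<close>.\<close>

type_synonym ('a, 'n) tangent = "('a, 'n) chart \<Rightarrow> real ^ 'n"

definition tangent_space :: "('a, 'n::finite) chart set \<Rightarrow> 'a \<Rightarrow> ('a, 'n) tangent set" where
  "tangent_space A x = {v.
     (\<forall>c. c \<notin> A \<or> x \<notin> fst c \<longrightarrow> v c = 0) \<and>
     (\<forall>c\<in>A. \<forall>d\<in>A. x \<in> fst c \<inter> fst d \<longrightarrow>
        v d = frechet_derivative (snd d \<circ> chart_inv c) (at (snd c x)) (v c))}"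

text \<open>The tangent vector at \<open>x\<close> with coordinates \<open>w\<close> in the chart \<open>c\<close>.\<close>

definition tangent_of ::
  "('a, 'n::finite) chart set \<Rightarrow> ('a, 'n) chart \<Rightarrow> 'a \<Rightarrow> real ^ 'n \<Rightarrow> ('a, 'n) tangent" where
  "tangent_of A c x w = (\<lambda>d. if d \<in> A \<and> x \<in> fst d
     then frechet_derivative (snd d \<circ> chart_inv c) (at (snd c x)) w else 0)"

definition smooth_field_on ::
  "('a, 'n::finite) chart set \<Rightarrow> 'a set \<Rightarrow> ('a \<Rightarrow> ('a, 'n) tangent) \<Rightarrow> bool" where
  "smooth_field_on A U X \<longleftrightarrow>
     (\<forall>x\<in>U. X x \<in> tangent_space A x) \<and>
     (\<forall>c\<in>A. smooth_on (snd c ` (fst c \<inter> U)) (\<lambda>y. X (chart_inv c y) c))"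

definition vector_fields ::
  "'a topology \<Rightarrow> ('a, 'n::finite) chart set \<Rightarrow> ('a \<Rightarrow> ('a, 'n) tangent) set" where
  "vector_fields M A = {X. smooth_field_on A (topspace M) X \<and> (\<forall>x. x \<notin> topspace M \<longrightarrow> X x = 0)}"

text \<open>Derivative of \<open>f\<close> at \<open>x\<close> in direction \<open>v\<close>; independent of the chart around \<open>x\<close>.\<close>

definition dir_deriv ::
  "('a, 'n::finite) chart set \<Rightarrow> 'a \<Rightarrow> ('a, 'n) tangent \<Rightarrow> ('a \<Rightarrow> real) \<Rightarrow> real" where
  "dir_deriv A x v f =
     (let c = chart_at A x in frechet_derivative (f \<circ> chart_inv c) (at (snd c x)) (v c))"

text \<open>The trace of a linear endomorphism of \<open>T\<^sub>xM\<close>, computed in a coordinate basis.\<close>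

definition endo_trace ::
  "('a, 'n::finite) chart set \<Rightarrow> 'a \<Rightarrow> (('a, 'n) tangent \<Rightarrow> ('a, 'n) tangent) \<Rightarrow> real" where
  "endo_trace A x L =
     (let c = chart_at A x in trace (matrix (\<lambda>w. L (tangent_of A c x w) c)))"


section \<open>Symmetric two-tensors and Riemannian metrics\<close>

text \<open>A form \<open>t\<close> on \<open>T\<^sub>xM\<close> is extended by zero to arguments outside \<open>T\<^sub>xM\<close>. Being curried, \<open>t\<close> is at
  the same time the map \<open>T\<^sub>xM \<rightarrow> T\<^sub>x\<^sup>*M\<close>, \<open>v \<mapsto> t v\<close>.\<close>

type_synonym ('a, 'n) form = "('a, 'n) tangent \<Rightarrow> ('a, 'n) tangent \<Rightarrow> real"

definition sym_forms :: "('a, 'n::finite) chart set \<Rightarrow> 'a \<Rightarrow> ('a, 'n) form set" where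
  "sym_forms A x = {t.
     (\<forall>v w. v \<notin> tangent_space A x \<or> w \<notin> tangent_space A x \<longrightarrow> t v w = 0) \<and>
     (\<forall>v\<in>tangent_space A x. \<forall>w\<in>tangent_space A x. t v w = t w v) \<and>
     (\<forall>u\<in>tangent_space A x. \<forall>v\<in>tangent_space A x. \<forall>w\<in>tangent_space A x. \<forall>a b.
        t (a *\<^sub>R u + b *\<^sub>R v) w = a * t u w + b * t v w)}"

definition form_matrix ::
  "('a, 'n::finite) chart set \<Rightarrow> ('a, 'n) chart \<Rightarrow> 'a \<Rightarrow> ('a, 'n) form \<Rightarrow> real ^ 'n ^ 'n" where
  "form_matrix A c x t =
     (\<chi> i j. t (tangent_of A c x (axis i 1)) (tangent_of A c x (axis j 1)))"

definition sym_tensor_fields ::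
  "'a topology \<Rightarrow> ('a, 'n::finite) chart set \<Rightarrow> ('a \<Rightarrow> ('a, 'n) form) set" where
  "sym_tensor_fields M A = {s.
     (\<forall>x\<in>topspace M. s x \<in> sym_forms A x) \<and> (\<forall>x. x \<notin> topspace M \<longrightarrow> s x = 0) \<and>
     (\<forall>c\<in>A. smooth_on (snd c ` fst c) (\<lambda>y. form_matrix A c (chart_inv c y) (s (chart_inv c y))))}"

definition riemannian_metrics ::
  "'a topology \<Rightarrow> ('a, 'n::finite) chart set \<Rightarrow> ('a \<Rightarrow> ('a, 'n) form) set" where
  "riemannian_metrics M A = {g \<in> sym_tensor_fields M A.
     \<forall>x\<in>topspace M. \<forall>v\<in>tangent_space A x. v \<noteq> 0 \<longrightarrow> g x v v > 0}"

definition borel_of_topology :: "'a topology \<Rightarrow> 'a measure" where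
  "borel_of_topology M = sigma (topspace M) {U. openin M U}"

text \<open>The measure \<open>\<surd>(det (g\<^sub>i\<^sub>j)) dy\<close> on the domain of the chart \<open>c\<close>, extended by zero to \<open>M\<close>.\<close>

definition chart_volume ::
  "'a topology \<Rightarrow> ('a, 'n::finite) chart set \<Rightarrow> ('a \<Rightarrow> ('a, 'n) form) \<Rightarrow> ('a, 'n) chart \<Rightarrow> 'a measure"
  where
  "chart_volume M A g c =
     distr
       (density (restrict_space lborel (snd c ` fst c))
         (\<lambda>y. ennreal (sqrt (det (form_matrix A c (chart_inv c y) (g (chart_inv c y)))))))
       (borel_of_topology M) (chart_inv c)"

text \<open>By the change of variables formula the chart measures agree on overlaps of charts. Their
  supremum in the lattice of measures (that is, the least Borel measure dominating all of them) is
  therefore the Riemannian volume measure, which restricts to \<open>chart_volume M A g c\<close> on the domain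
  of every chart \<open>c\<close>; if \<open>M\<close> has uncountably many components, it sums the volumes of the
  components.\<close>

definition riemannian_volume ::
  "'a topology \<Rightarrow> ('a, 'n::finite) chart set \<Rightarrow> ('a \<Rightarrow> ('a, 'n) form) \<Rightarrow> 'a measure" where
  "riemannian_volume M A g = (SUP c\<in>A. chart_volume M A g c)"

definition finite_volume_metrics ::
  "'a topology \<Rightarrow> ('a, 'n::finite) chart set \<Rightarrow> ('a \<Rightarrow> ('a, 'n) form) set" where
  "finite_volume_metrics M A =
     {g \<in> riemannian_metrics M A. emeasure (riemannian_volume M A g) (topspace M) < \<infinity>}"

text \<open>\<open>\<sharp> = g\<^sup>-\<^sup>1 : T\<^sub>x\<^sup>*M \<rightarrow> T\<^sub>xM\<close>, for \<open>g\<close> positive definite on \<open>T\<^sub>xM\<close>.\<close>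

definition sharp ::
  "('a, 'n::finite) chart set \<Rightarrow> 'a \<Rightarrow> ('a, 'n) form \<Rightarrow> (('a, 'n) tangent \<Rightarrow> real) \<Rightarrow> ('a, 'n) tangent"
  where
  "sharp A x g = inv_into (tangent_space A x) g"

definition local_orthonormal_frame ::
  "'a topology \<Rightarrow> ('a, 'n::finite) chart set \<Rightarrow> ('a \<Rightarrow> ('a, 'n) form) \<Rightarrow>
    'a set \<Rightarrow> ('n \<Rightarrow> 'a \<Rightarrow> ('a, 'n) tangent) \<Rightarrow> bool" where
  "local_orthonormal_frame M A g U E \<longleftrightarrow>
     openin M U \<and> (\<forall>i. smooth_field_on A U (E i)) \<and>
     (\<forall>x\<in>U. \<forall>i j. g x (E i x) (E j x) = (if i = j then 1 else 0))"


section \<open>Connections and jets\<close>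

text \<open>A connection on the vector bundle whose smooth sections are \<open>\<Gamma>\<close>.\<close>

definition connection ::
  "'a topology \<Rightarrow> ('a, 'n::finite) chart set \<Rightarrow> ('a \<Rightarrow> 'b::real_vector) set \<Rightarrow>
    (('a \<Rightarrow> ('a, 'n) tangent) \<Rightarrow> ('a \<Rightarrow> 'b) \<Rightarrow> ('a \<Rightarrow> 'b)) \<Rightarrow> bool" where
  "connection M A \<Gamma> nabla \<longleftrightarrow>
     (\<forall>X\<in>vector_fields M A. \<forall>s\<in>\<Gamma>. nabla X s \<in> \<Gamma>) \<and>
     (\<forall>X\<in>vector_fields M A. \<forall>Y\<in>vector_fields M A. \<forall>s\<in>\<Gamma>. nabla (X + Y) s = nabla X s + nabla Y s) \<and>
     (\<forall>X\<in>vector_fields M A. \<forall>s\<in>\<Gamma>. \<forall>t\<in>\<Gamma>. nabla X (s + t) = nabla X s + nabla X t) \<and>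
     (\<forall>X\<in>vector_fields M A. \<forall>s\<in>\<Gamma>. \<forall>f\<in>smooth_functions A.
        nabla (\<lambda>x. f x *\<^sub>R X x) s = (\<lambda>x. f x *\<^sub>R nabla X s x) \<and>
        nabla X (\<lambda>x. f x *\<^sub>R s x) =
          (\<lambda>x. dir_deriv A x (X x) f *\<^sub>R s x + f x *\<^sub>R nabla X s x))"

text \<open>Iterated covariant derivative \<open>\<nabla>\<^sup>i\<sigma>\<close>, evaluated on a list of \<open>i\<close> vector fields:
  \<open>(\<nabla>\<^sup>i\<^sup>+\<^sup>1\<sigma>)(X, Y\<^sub>1, \<dots>, Y\<^sub>i) = \<nabla>\<^sub>X((\<nabla>\<^sup>i\<sigma>)(Y\<^sub>1, \<dots>, Y\<^sub>i)) - (\<Sum>\<^sub>j (\<nabla>\<^sup>i\<sigma>)(Y\<^sub>1, \<dots>, \<nabla>\<^sub>XY\<^sub>j, \<dots>, Y\<^sub>i))\<close>.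
  Here \<open>nT\<close> is the connection on \<open>TM\<close> and \<open>nE\<close> the one on \<open>S\<^sup>2T\<^sup>*M\<close>.\<close>

primrec covariant_derivs ::
  "(('a \<Rightarrow> ('a, 'n::finite) tangent) \<Rightarrow> ('a \<Rightarrow> ('a, 'n) tangent) \<Rightarrow> ('a \<Rightarrow> ('a, 'n) tangent)) \<Rightarrow>
   (('a \<Rightarrow> ('a, 'n) tangent) \<Rightarrow> ('a \<Rightarrow> ('a, 'n) form) \<Rightarrow> ('a \<Rightarrow> ('a, 'n) form)) \<Rightarrow>
   ('a \<Rightarrow> ('a, 'n) form) \<Rightarrow> nat \<Rightarrow> ('a \<Rightarrow> ('a, 'n) tangent) list \<Rightarrow> ('a \<Rightarrow> ('a, 'n) form)" where
  "covariant_derivs nT nE \<sigma> 0 Xs = \<sigma>"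
| "covariant_derivs nT nE \<sigma> (Suc i) Xs =
     nE (hd Xs) (covariant_derivs nT nE \<sigma> i (tl Xs)) -
     (\<Sum>j<i. covariant_derivs nT nE \<sigma> i ((tl Xs)[j := nT (hd Xs) (tl Xs ! j)]))"

definition sym_covariant_derivs ::
  "(('a \<Rightarrow> ('a, 'n::finite) tangent) \<Rightarrow> ('a \<Rightarrow> ('a, 'n) tangent) \<Rightarrow> ('a \<Rightarrow> ('a, 'n) tangent)) \<Rightarrow>
   (('a \<Rightarrow> ('a, 'n) tangent) \<Rightarrow> ('a \<Rightarrow> ('a, 'n) form) \<Rightarrow> ('a \<Rightarrow> ('a, 'n) form)) \<Rightarrow>
   ('a \<Rightarrow> ('a, 'n) form) \<Rightarrow> nat \<Rightarrow> ('a \<Rightarrow> ('a, 'n) tangent) list \<Rightarrow> ('a \<Rightarrow> ('a, 'n) form)" where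
  "sym_covariant_derivs nT nE \<sigma> i Xs =
     (1 / fact i) *\<^sub>R
     (\<Sum>p | p permutes {..<i}. covariant_derivs nT nE \<sigma> i (permute_list p Xs))"

definition extend_vector ::
  "'a topology \<Rightarrow> ('a, 'n::finite) chart set \<Rightarrow> 'a \<Rightarrow> ('a, 'n) tangent \<Rightarrow> ('a \<Rightarrow> ('a, 'n) tangent)" where
  "extend_vector M A x v = (SOME X. X \<in> vector_fields M A \<and> X x = v)"

text \<open>An element of the fibre at \<open>x\<close> of \<open>\<Oplus>\<^sub>i\<^sub>\<le>\<^sub>k L\<^sub>s(TM\<^sup>i, S\<^sup>2T\<^sup>*M)\<close> is a tuple \<open>(t\<^sub>0, \<dots>, t\<^sub>k)\<close>, here a
  function on indices which vanishes beyond \<open>k\<close>; each \<open>t\<^sub>i\<close> takes the list of its \<open>i\<close> arguments and is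
  extended by zero to all other lists.\<close>

type_synonym ('a, 'n) jet = "nat \<Rightarrow> ('a, 'n) tangent list \<Rightarrow> ('a, 'n) form"

definition jet_fibre :: "('a, 'n::finite) chart set \<Rightarrow> nat \<Rightarrow> 'a \<Rightarrow> ('a, 'n) jet set" where
  "jet_fibre A k x = {t.
     (\<forall>i vs. \<not> (i \<le> k \<and> length vs = i \<and> set vs \<subseteq> tangent_space A x) \<longrightarrow> t i vs = 0) \<and>
     (\<forall>i\<le>k. \<forall>vs. length vs = i \<and> set vs \<subseteq> tangent_space A x \<longrightarrow>
        t i vs \<in> sym_forms A x \<and>
        (\<forall>p. p permutes {..<i} \<longrightarrow> t i (permute_list p vs) = t i vs) \<and>
        (\<forall>j<i. \<forall>u\<in>tangent_space A x. \<forall>v\<in>tangent_space A x. \<forall>a b.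
           t i (vs[j := a *\<^sub>R u + b *\<^sub>R v]) = a *\<^sub>R t i (vs[j := u]) + b *\<^sub>R t i (vs[j := v])))}"

text \<open>The image of \<open>j\<^sup>k\<sigma>\<close> under the isomorphism \<open>J\<^sup>kE \<cong> \<Oplus>\<^sub>i\<^sub>\<le>\<^sub>k L\<^sub>s(TM\<^sup>i, E)\<close> given by the connections:
  its \<open>i\<close>-th component is the symmetrized \<open>i\<close>-th covariant derivative. As that is tensorial, the
  choice made by \<open>extend_vector\<close> does not matter.\<close>

definition jet ::
  "'a topology \<Rightarrow> ('a, 'n::finite) chart set \<Rightarrow>
   (('a \<Rightarrow> ('a, 'n) tangent) \<Rightarrow> ('a \<Rightarrow> ('a, 'n) tangent) \<Rightarrow> ('a \<Rightarrow> ('a, 'n) tangent)) \<Rightarrow>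
   (('a \<Rightarrow> ('a, 'n) tangent) \<Rightarrow> ('a \<Rightarrow> ('a, 'n) form) \<Rightarrow> ('a \<Rightarrow> ('a, 'n) form)) \<Rightarrow>
   nat \<Rightarrow> ('a \<Rightarrow> ('a, 'n) form) \<Rightarrow> ('a \<Rightarrow> ('a, 'n) jet)" where
  "jet M A nT nE k \<sigma> x = (\<lambda>i vs.
     if i \<le> k \<and> length vs = i \<and> set vs \<subseteq> tangent_space A x
     then sym_covariant_derivs nT nE \<sigma> i (map (extend_vector M A x) vs) x else 0)"


section \<open>Cone fields and the space of indefinitely measurable sections\<close>

text \<open>The interior of a subset of \<open>T\<^sub>xM\<close>, and the openness of a subset of the total space of \<open>TM\<close>,
  refer to the topologies transported by the bundle charts.\<close>

definition fibre_interior ::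
  "('a, 'n::finite) chart set \<Rightarrow> 'a \<Rightarrow> ('a, 'n) tangent set \<Rightarrow> ('a, 'n) tangent set" where
  "fibre_interior A x S =
     {v \<in> tangent_space A x. \<forall>c\<in>A. x \<in> fst c \<longrightarrow> v c \<in> interior ((\<lambda>w. w c) ` S)}"

definition open_in_total ::
  "'a topology \<Rightarrow> ('a, 'n::finite) chart set \<Rightarrow> ('a \<times> ('a, 'n) tangent) set \<Rightarrow> bool" where
  "open_in_total M A W \<longleftrightarrow>
     W \<subseteq> Sigma (topspace M) (tangent_space A) \<and>
     (\<forall>c\<in>A. open {(snd c x, v c) |x v. x \<in> fst c \<and> (x, v) \<in> W})"

definition tangent_cone_field ::
  "'a topology \<Rightarrow> ('a, 'n::finite) chart set \<Rightarrow> ('a \<Rightarrow> ('a, 'n) tangent set) \<Rightarrow> bool" where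
  "tangent_cone_field M A K \<longleftrightarrow>
     (\<forall>x\<in>topspace M. K x \<subseteq> tangent_space A x \<and> convex (K x) \<and> cone (K x) \<and>
        (\<forall>c\<in>A. x \<in> fst c \<longrightarrow> closed ((\<lambda>v. v c) ` K x)) \<and>
        K x \<inter> uminus ` K x = {0} \<and> fibre_interior A x (K x) \<noteq> {}) \<and>
     open_in_total M A (SIGMA x:topspace M. fibre_interior A x (K x)) \<and>
     open_in_total M A (SIGMA x:topspace M. tangent_space A x - K x)"

definition psd_cone :: "('a, 'n::finite) chart set \<Rightarrow> 'a \<Rightarrow> ('a, 'n) form set" where
  "psd_cone A x = {t \<in> sym_forms A x. \<forall>v\<in>tangent_space A x. t v v \<ge> 0}"

text \<open>The cone field \<open>K\<^sup>k\<close> on the bundle of \<open>k\<close>-jets induced by the cone field of positive semidefinite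
  forms and the cone field \<open>KT\<close> on \<open>TM\<close>. The component \<open>t\<^sub>0\<close> is \<open>t 0 []\<close>.\<close>

definition jet_cone ::
  "('a, 'n::finite) chart set \<Rightarrow> ('a \<Rightarrow> ('a, 'n) tangent set) \<Rightarrow> nat \<Rightarrow> 'a \<Rightarrow> ('a, 'n) jet set" where
  "jet_cone A KT k x = {t \<in> jet_fibre A k x.
     \<forall>i\<le>k. \<forall>vs. length vs = i \<and> set vs \<subseteq> KT x \<longrightarrow> t i vs \<in> psd_cone A x}"

definition jet_le ::
  "'a topology \<Rightarrow> ('a, 'n::finite) chart set \<Rightarrow> ('a \<Rightarrow> ('a, 'n) tangent set) \<Rightarrow> nat \<Rightarrow>
   ('a \<Rightarrow> ('a, 'n) jet) \<Rightarrow> ('a \<Rightarrow> ('a, 'n) jet) \<Rightarrow> bool" where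
  "jet_le M A KT i a b \<longleftrightarrow> (\<forall>x\<in>topspace M. b x - a x \<in> jet_cone A KT i x)"

text \<open>The space \<open>\<Gamma>\<^sub>g\<close>, the model space of the manifold of metrics around \<open>g\<close> and hence its tangent
  space at \<open>g\<close>.\<close>

definition indef_measurable_sections ::
  "'a topology \<Rightarrow> ('a, 'n::finite) chart set \<Rightarrow>
   (('a \<Rightarrow> ('a, 'n) tangent) \<Rightarrow> ('a \<Rightarrow> ('a, 'n) tangent) \<Rightarrow> ('a \<Rightarrow> ('a, 'n) tangent)) \<Rightarrow>
   (('a \<Rightarrow> ('a, 'n) tangent) \<Rightarrow> ('a \<Rightarrow> ('a, 'n) form) \<Rightarrow> ('a \<Rightarrow> ('a, 'n) form)) \<Rightarrow>
   ('a \<Rightarrow> ('a, 'n) tangent set) \<Rightarrow> ('a \<Rightarrow> ('a, 'n) form) \<Rightarrow> ('a \<Rightarrow> ('a, 'n) form) set" where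
  "indef_measurable_sections M A nT nE KT g = {\<sigma> \<in> sym_tensor_fields M A.
     \<forall>k. \<exists>l\<ge>0. \<forall>i\<le>k.
       jet_le M A KT i ((- l) *\<^sub>R jet M A nT nE i g) (jet M A nT nE i \<sigma>) \<and>
       jet_le M A KT i (jet M A nT nE i \<sigma>) (l *\<^sub>R jet M A nT nE i g)}"


section \<open>The metric on the space of metrics\<close>

definition metric_trace ::
  "('a, 'n::finite) chart set \<Rightarrow> ('a \<Rightarrow> ('a, 'n) form) \<Rightarrow> ('a \<Rightarrow> ('a, 'n) form) \<Rightarrow>
   ('a \<Rightarrow> ('a, 'n) form) \<Rightarrow> 'a \<Rightarrow> real" where
  "metric_trace A g h k x =
     endo_trace A x (sharp A x (g x) \<circ> h x \<circ> sharp A x (g x) \<circ> k x)"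

definition frame_sum ::
  "('a, 'n::finite) chart set \<Rightarrow> ('a \<Rightarrow> ('a, 'n) form) \<Rightarrow> ('a \<Rightarrow> ('a, 'n) form) \<Rightarrow>
   ('a \<Rightarrow> ('a, 'n) form) \<Rightarrow> ('n \<Rightarrow> 'a \<Rightarrow> ('a, 'n) tangent) \<Rightarrow> 'a \<Rightarrow> real" where
  "frame_sum A g h k E x = (\<Sum>i\<in>UNIV. h x (sharp A x (g x) (k x (E i x))) (E i x))"

definition L2_metric ::
  "'a topology \<Rightarrow> ('a, 'n::finite) chart set \<Rightarrow> ('a \<Rightarrow> ('a, 'n) form) \<Rightarrow>
   ('a \<Rightarrow> ('a, 'n) form) \<Rightarrow> ('a \<Rightarrow> ('a, 'n) form) \<Rightarrow> real" where
  "L2_metric M A g h k = (LINT x|riemannian_volume M A g. metric_trace A g h k x)"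

end

theory Submission
  imports Defs
begin

text \<open>The integrand \<open>trace (g\<^sup>-\<^sup>1hg\<^sup>-\<^sup>1k)\<close> is a bounded continuous function on \<open>M\<close>, and a bounded measurable
  function is integrable for a finite measure.

  Everything rests on evaluating the trace in a basis \<open>(e\<^sub>i)\<close> of \<open>T\<^sub>xM\<close> that is orthonormal for \<open>g\<close>. If \<open>P\<close>
  is the matrix whose columns are the coordinate vectors of the \<open>e\<^sub>i\<close>, then orthonormality reads
  \<open>P\<^sup>TGP = 1\<close>, that is \<open>G\<^sup>-\<^sup>1 = PP\<^sup>T\<close>. Cyclicity of the trace turns \<open>trace (G\<^sup>-\<^sup>1HG\<^sup>-\<^sup>1K)\<close> into the frame sum
  \<open>\<Sum>\<^sub>i h((k e\<^sub>i)\<^sup>\<sharp>, e\<^sub>i)\<close>, in which no chart occurs. This has three consequences. It is the second formula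
  for the integrand (\<open>metric_trace_eq_frame_sum\<close>). It shows that the trace is the same in every chart
  around \<open>x\<close> (\<open>metric_trace_coords\<close>), although its definition picks an arbitrary one for each \<open>x\<close>; near a
  given point one chart can therefore be used, where the entries of \<open>G\<^sup>-\<^sup>1\<close> are continuous by Cramer's
  rule, and the integrand is continuous (\<open>metric_trace_continuous\<close>). Finally, expanding \<open>(k e\<^sub>i)\<^sup>\<sharp>\<close> in the
  basis gives \<open>\<Sum>\<^sub>i\<^sub>,\<^sub>j h(e\<^sub>i, e\<^sub>j) k(e\<^sub>i, e\<^sub>j)\<close> (\<open>frame_sum_expand\<close>).

  The order-zero part of indefinite measurability says \<open>-\<lambda>g \<le> h \<le> \<lambda>g\<close> and \<open>-\<mu>g \<le> k \<le> \<mu>g\<close> as quadratic forms.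
  By polarization \<open>\<bar>h(e\<^sub>i, e\<^sub>j)\<bar> \<le> \<lambda>\<close> and \<open>\<bar>k(e\<^sub>i, e\<^sub>j)\<bar> \<le> \<mu>\<close>, so the integrand is bounded by \<open>n\<^sup>2\<lambda>\<mu>\<close>
  (\<open>metric_trace_bound\<close>).\<close>


section \<open>Orthonormal bases for a positive definite matrix\<close>

definition positive_definite :: "real ^ 'n ^ 'n::finite \<Rightarrow> bool" where
  "positive_definite G \<longleftrightarrow> transpose G = G \<and> (\<forall>v. v \<noteq> 0 \<longrightarrow> v \<bullet> (G *v v) > 0)"

text \<open>The family is indexed by the index type of the matrix, so it is automatically a basis.\<close>

definition matrix_orthonormal :: "real ^ 'n ^ 'n::finite \<Rightarrow> ('n \<Rightarrow> real ^ 'n) \<Rightarrow> bool" where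
  "matrix_orthonormal G e \<longleftrightarrow> (\<forall>i j. e i \<bullet> (G *v e j) = (if i = j then 1 else 0))"

lemma inner_symmetric_matrix_commute:
  fixes B :: "real ^ 'n ^ 'n::finite"
  assumes "transpose B = B"
  shows "v \<bullet> (B *v w) = w \<bullet> (B *v v)"
  by (metis assms dot_lmul_matrix inner_commute transpose_matrix_vector)

lemma invertible_positive_definite:
  fixes G :: "real ^ 'n ^ 'n::finite"
  assumes "positive_definite G"
  shows "invertible G"
proof -
  have "v = 0" if "G *v v = 0" for v
    using assms that unfolding positive_definite_def by (cases "v = 0") auto
  then show ?thesis
    by (meson invertible_left_inverse matrix_left_invertible_ker)
qed

lemma matrix_inv_right_inverse:
  fixes G :: "real ^ 'n ^ 'n::finite"
  assumes "invertible G"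
  shows "G ** matrix_inv G = mat 1"
  using someI_ex[OF assms[unfolded invertible_def]] by (simp add: matrix_inv_def)

lemma matrix_vector_mult_matrix_inv:
  fixes G :: "real ^ 'n ^ 'n::finite"
  assumes "invertible G"
  shows "G *v (matrix_inv G *v v) = v"
  using matrix_inv_right_inverse[OF assms] by (simp add: matrix_vector_mul_assoc)

text \<open>A formula for the entries of the inverse by determinants, from which continuity can be read
  off: column \<open>j\<close> of the inverse solves \<open>Gv = e\<^sub>j\<close>.\<close>

lemma matrix_inv_nth_cramer:
  fixes G :: "real ^ 'n ^ 'n::finite"
  assumes "invertible G"
  shows "matrix_inv G $ i $ j =
    det (\<chi> a b. if b = i then (axis j 1 :: real ^ 'n) $ a else G $ a $ b) / det G"
proof -
  have "G *v (matrix_inv G *v axis j 1) = axis j 1"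
    by (rule matrix_vector_mult_matrix_inv[OF assms])
  moreover have "det G \<noteq> 0"
    using assms invertible_det_nz by blast
  ultimately have "matrix_inv G *v axis j 1 =
      (\<chi> k. det (\<chi> a b. if b = k then (axis j 1 :: real ^ 'n) $ a else G $ a $ b) / det G)"
    using cramer by blast
  moreover have "matrix_inv G $ i $ j = (matrix_inv G *v axis j 1) $ i"
    by (simp add: matrix_vector_mult_basis column_def)
  ultimately show ?thesis
    by simp
qed

lemma continuous_on_det [continuous_intros]:
  fixes F :: "'b::topological_space \<Rightarrow> real ^ 'n ^ 'n::finite"
  assumes "continuous_on S F"
  shows "continuous_on S (\<lambda>y. det (F y))"
  unfolding det_def using assms by (intro continuous_intros)

lemma continuous_on_matrix_inv [continuous_intros]:
  fixes F :: "'b::topological_space \<Rightarrow> real ^ 'n ^ 'n::finite"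
  assumes F: "continuous_on S F" and inv: "\<And>y. y \<in> S \<Longrightarrow> invertible (F y)"
  shows "continuous_on S (\<lambda>y. matrix_inv (F y))"
proof -
  have *: "continuous_on S (\<lambda>y. matrix_inv (F y) $ i $ j)" for i j
  proof -
    have "continuous_on S (\<lambda>y. det (\<chi> a b. if b = i then (axis j 1 :: real ^ 'n) $ a else F y $ a $ b) / det (F y))"
    proof (intro continuous_intros F)
      show "\<forall>y\<in>S. det (F y) \<noteq> 0"
        using inv invertible_det_nz by blast
      show "continuous_on S (\<lambda>y. if b = i then (axis j 1 :: real ^ 'n) $ a else F y $ a $ b)" for a b
        by (cases "b = i") (auto intro!: continuous_intros F)
    qed
    then show ?thesis
      by (rule continuous_on_eq) (simp add: matrix_inv_nth_cramer[OF inv])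
  qed
  have "continuous_on S (\<lambda>y. \<chi> i j. matrix_inv (F y) $ i $ j)"
    by (intro continuous_intros *)
  then show ?thesis
    by simp
qed

lemma continuous_on_matrix_matrix_mult [continuous_intros]:
  fixes F H :: "'b::topological_space \<Rightarrow> real ^ 'n ^ 'n::finite"
  assumes "continuous_on S F" "continuous_on S H"
  shows "continuous_on S (\<lambda>y. F y ** H y)"
  unfolding matrix_matrix_mult_def using assms by (intro continuous_intros)

lemma continuous_on_trace [continuous_intros]:
  fixes F :: "'b::topological_space \<Rightarrow> real ^ 'n ^ 'n::finite"
  assumes "continuous_on S F"
  shows "continuous_on S (\<lambda>y. trace (F y))"
  unfolding trace_def using assms by (intro continuous_intros)

lemma independent_matrix_orthonormal:
  fixes G :: "real ^ 'n ^ 'n::finite"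
  assumes "finite B" and on: "\<And>b b'. b \<in> B \<Longrightarrow> b' \<in> B \<Longrightarrow> b \<bullet> (G *v b') = (if b = b' then 1 else 0)"
  shows "independent B"
proof (rule independent_if_scalars_zero[OF assms(1)])
  fix f x assume 0: "(\<Sum>v\<in>B. f v *\<^sub>R v) = 0" and x: "x \<in> B"
  have "0 = (\<Sum>v\<in>B. f v *\<^sub>R v) \<bullet> (G *v x)"
    by (simp add: 0)
  also have "\<dots> = (\<Sum>v\<in>B. if v = x then f v else 0)"
    unfolding inner_sum_left by (rule sum.cong) (auto simp: on x)
  also have "\<dots> = f x"
    using assms(1) x by (simp)
  finally show "f x = 0" by simp
qed

text \<open>A largest orthonormal set spans: otherwise, as in the Gram-Schmidt process, the normalized
  component of a vector outside the span, orthogonal to the set, could be added. Independence bounds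
  the size of orthonormal sets by the dimension, so a largest one exists.\<close>

lemma exists_matrix_orthonormal:
  fixes G :: "real ^ 'n ^ 'n::finite"
  assumes "positive_definite G"
  obtains e where "matrix_orthonormal G e"
proof -
  have sym: "transpose G = G" and pos: "v \<noteq> 0 \<Longrightarrow> v \<bullet> (G *v v) > 0" for v
    using assms by (auto simp: positive_definite_def)
  define P where "P B \<longleftrightarrow> finite B \<and>
    (\<forall>b\<in>B. \<forall>b'\<in>B. b \<bullet> (G *v b') = (if b = b' then 1 else 0))" for B :: "(real ^ 'n) set"
  have bound: "card B \<le> CARD('n)" if "P B" for B
    using that independent_bound[OF independent_matrix_orthonormal[of B G]] unfolding P_def by auto
  have "P {}" by (simp add: P_def)
  then obtain B where B: "P B" and max: "\<And>C. P C \<Longrightarrow> card C \<le> card B"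
    using ex_has_greatest_nat[of P "{}" card "Suc CARD('n)"] bound by (metis less_Suc_eq_le)
  have fin: "finite B" and on: "b \<in> B \<Longrightarrow> b' \<in> B \<Longrightarrow> b \<bullet> (G *v b') = (if b = b' then 1 else 0)" for b b'
    using B by (auto simp: P_def)
  have "UNIV \<subseteq> span B"
  proof
    fix v :: "real ^ 'n"
    define p where "p = (\<Sum>b\<in>B. (b \<bullet> (G *v v)) *\<^sub>R b)"
    have p: "p \<in> span B"
      unfolding p_def by (intro span_sum span_scale span_base)
    show "v \<in> span B"
    proof (rule ccontr)
      assume "v \<notin> span B"
      define u where "u = v - p"
      have u0: "u \<noteq> 0" using p \<open>v \<notin> span B\<close> by (auto simp: u_def)
      define s where "s = sqrt (u \<bullet> (G *v u))"
      have s: "s > 0" "s * s = u \<bullet> (G *v u)"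
        using pos[OF u0] by (auto simp: s_def)
      have orth: "u \<bullet> (G *v b) = 0" if "b \<in> B" for b
      proof -
        have "p \<bullet> (G *v b) = (\<Sum>b'\<in>B. if b' = b then b' \<bullet> (G *v v) else 0)"
          unfolding p_def inner_sum_left by (rule sum.cong) (auto simp: on that)
        also have "\<dots> = v \<bullet> (G *v b)"
          using fin that inner_symmetric_matrix_commute[OF sym, of b v] by simp
        finally show ?thesis by (simp add: u_def inner_diff_left)
      qed
      define w where "w = (1 / s) *\<^sub>R u"
      have w1: "w \<bullet> (G *v w) = 1"
      proof -
        have "w \<bullet> (G *v w) = (u \<bullet> (G *v u)) / (s * s)"
          by (simp add: w_def matrix_vector_mult_scaleR)
        then show ?thesis
          using s(1) unfolding s(2)[symmetric] by simp
      qed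
      have w0: "w \<bullet> (G *v b) = 0" "b \<bullet> (G *v w) = 0" if "b \<in> B" for b
        using orth[OF that] inner_symmetric_matrix_commute[OF sym, of b w] by (simp_all add: w_def)
      have "w \<notin> B" using w1 w0 by force
      have "P (insert w B)"
        using fin on w1 w0 \<open>w \<notin> B\<close> by (auto simp: P_def)
      from max[OF this] show False
        using fin \<open>w \<notin> B\<close> by simp
    qed
  qed
  then have "card B = CARD('n)"
    using bound[OF B] span_card_ge_dim[of B UNIV] fin by (simp add: dim_UNIV)
  then obtain e where e: "bij_betw e (UNIV :: 'n set) B"
    using fin by (metis finite_same_card_bij finite_class.finite_UNIV)
  show ?thesis
  proof (rule that, unfold matrix_orthonormal_def, intro allI)
    fix i j
    have "e i \<in> B" "e j \<in> B" "e i = e j \<longleftrightarrow> i = j"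
      using e by (auto simp: bij_betw_def inj_eq)
    then show "e i \<bullet> (G *v e j) = (if i = j then 1 else 0)"
      by (simp add: on)
  qed
qed

text \<open>Orthonormality is \<open>P\<^sup>TGP = 1\<close>. A one-sided inverse of a square matrix is two-sided, so
  \<open>PP\<^sup>TG = 1\<close>.\<close>

lemma orthonormal_basis_matrix_inv:
  fixes G :: "real ^ 'n ^ 'n::finite"
  assumes "matrix_orthonormal G e"
  defines "P \<equiv> (\<chi> a i. e i $ a)"
  shows "matrix_inv G = P ** transpose P"
proof -
  have "(transpose P ** (G ** P)) $ i $ j = e i \<bullet> (G *v e j)" for i j
    by (simp add: P_def transpose_def inner_vec_def matrix_vector_mult_def matrix_matrix_mult_def)
  then have "transpose P ** (G ** P) = mat 1"
    using assms(1) by (simp add: vec_eq_iff mat_def matrix_orthonormal_def)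
  then have "(transpose P ** G) ** P = mat 1"
    by (simp add: matrix_mul_assoc)
  then have 1: "P ** (transpose P ** G) = mat 1"
    using matrix_left_right_inverse by blast
  then have 2: "(P ** transpose P) ** G = mat 1"
    by (simp add: matrix_mul_assoc)
  have "invertible G" using 2 invertible_left_inverse by blast
  then have "G ** matrix_inv G = mat 1" by (rule matrix_inv_right_inverse)
  then show ?thesis
    using 2 by (metis matrix_mul_assoc matrix_mul_lid matrix_mul_rid)
qed

lemma matrix_inv_vector_orthonormal_basis:
  fixes G :: "real ^ 'n ^ 'n::finite"
  assumes "matrix_orthonormal G e"
  shows "matrix_inv G *v v = (\<Sum>j\<in>UNIV. (e j \<bullet> v) *\<^sub>R e j)"
proof -
  define P :: "real ^ 'n ^ 'n" where "P = (\<chi> a i. e i $ a)"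
  have "matrix_inv G *v v = P *v (transpose P *v v)"
    unfolding orthonormal_basis_matrix_inv[OF assms] P_def[symmetric]
    by (simp only: matrix_vector_mul_assoc)
  then show ?thesis
    by (simp add: vec_eq_iff P_def matrix_vector_mult_def transpose_def inner_vec_def mult.commute)
qed

text \<open>By cyclicity, \<open>trace (PP\<^sup>TB) = trace (P\<^sup>TBP)\<close>, and the diagonal entries of \<open>P\<^sup>TBP\<close> are the summands.\<close>

lemma trace_matrix_inv_orthonormal_basis:
  fixes G B :: "real ^ 'n ^ 'n::finite"
  assumes "matrix_orthonormal G e"
  shows "trace (matrix_inv G ** B) = (\<Sum>i\<in>UNIV. e i \<bullet> (B *v e i))"
proof -
  define P :: "real ^ 'n ^ 'n" where "P = (\<chi> a i. e i $ a)"
  have "trace (matrix_inv G ** B) = trace (transpose P ** (B ** P))"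
    unfolding orthonormal_basis_matrix_inv[OF assms] P_def[symmetric]
    by (metis matrix_mul_assoc trace_mul_sym)
  also have "\<dots> = (\<Sum>i\<in>UNIV. e i \<bullet> (B *v e i))"
    by (simp add: trace_def P_def matrix_matrix_mult_def transpose_def inner_vec_def matrix_vector_mult_def)
  finally show ?thesis .
qed

text \<open>From the diagonal to arbitrary entries: \<open>4H(v, w) = H(v + w, v + w) - H(v - w, v - w)\<close>, and by the
  parallelogram law the squared \<open>G\<close>-lengths of \<open>v + w\<close> and \<open>v - w\<close> add up to \<open>4\<close>.\<close>

lemma polarization_bound:
  fixes G H :: "real ^ 'n ^ 'n::finite"
  assumes symH: "transpose H = H"
    and le: "\<And>u. \<bar>u \<bullet> (H *v u)\<bar> \<le> l * (u \<bullet> (G *v u))"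
    and v: "v \<bullet> (G *v v) = 1" and w: "w \<bullet> (G *v w) = 1"
  shows "\<bar>v \<bullet> (H *v w)\<bar> \<le> l"
proof -
  have H: "4 * (v \<bullet> (H *v w)) = (v + w) \<bullet> (H *v (v + w)) - (v - w) \<bullet> (H *v (v - w))"
    using inner_symmetric_matrix_commute[OF symH, of w v]
    by (simp add: matrix_vector_right_distrib matrix_vector_mult_diff_distrib inner_add_left
        inner_diff_left inner_add_right inner_diff_right)
  have G: "(v + w) \<bullet> (G *v (v + w)) + (v - w) \<bullet> (G *v (v - w)) = 4"
    using v w
    by (simp add: matrix_vector_right_distrib matrix_vector_mult_diff_distrib inner_add_left
        inner_diff_left inner_add_right inner_diff_right)
  have "\<bar>4 * (v \<bullet> (H *v w))\<bar> \<le>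
      l * ((v + w) \<bullet> (G *v (v + w))) + l * ((v - w) \<bullet> (G *v (v - w)))"
    unfolding H using le[of "v + w"] le[of "v - w"] by linarith
  also have "\<dots> = l * 4"
    unfolding G[symmetric] by (simp add: distrib_left)
  finally show ?thesis by simp
qed


section \<open>Tangent vectors in coordinates\<close>

lemma chart_inj_on:
  assumes "is_chart M c"
  shows "inj_on (snd c) (fst c)"
proof -
  have "topspace (subtopology M (fst c)) = fst c"
    using assms openin_subset unfolding is_chart_def by fastforce
  then show ?thesis
    using assms homeomorphic_imp_injective_map unfolding is_chart_def by metis
qed

lemma chart_overlap_open:
  assumes "is_chart M c" "is_chart M d"
  shows "open (snd c ` (fst c \<inter> fst d))"
proof -
  have "openin (subtopology M (fst c)) (fst c \<inter> fst d)"
    using assms by (auto simp: is_chart_def openin_subtopology_Int2)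
  then have "openin (top_of_set (snd c ` fst c)) (snd c ` (fst c \<inter> fst d))"
    using assms(1) homeomorphic_imp_open_map unfolding is_chart_def open_map_def by blast
  then show ?thesis
    using assms(1) openin_open_trans unfolding is_chart_def by blast
qed

lemma manifold_chart:
  assumes "smooth_manifold M A" "c \<in> A"
  shows "is_chart M c"
  using assms by (simp add: smooth_manifold_def)

lemma chart_inv_chart:
  assumes "smooth_manifold M A" "c \<in> A" "x \<in> fst c"
  shows "chart_inv c (snd c x) = x"
  using chart_inj_on[OF manifold_chart[OF assms(1,2)]] assms(3) by simp

lemma chart_at_mem:
  assumes "smooth_manifold M A" "x \<in> topspace M"
  shows "chart_at A x \<in> A" "x \<in> fst (chart_at A x)"
proof -
  have "\<exists>c. c \<in> A \<and> x \<in> fst c"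
    using assms unfolding smooth_manifold_def by (metis UN_E)
  from someI_ex[OF this] show "chart_at A x \<in> A" "x \<in> fst (chart_at A x)"
    by (simp_all add: chart_at_def)
qed

abbreviation transition_deriv ::
  "('a, 'n::finite) chart \<Rightarrow> ('a, 'n) chart \<Rightarrow> 'a \<Rightarrow> real ^ 'n \<Rightarrow> real ^ 'n" where
  "transition_deriv c d x \<equiv> frechet_derivative (snd d \<circ> chart_inv c) (at (snd c x))"

lemma transition_differentiable:
  assumes "smooth_manifold M A" "c \<in> A" "d \<in> A" "x \<in> fst c" "x \<in> fst d"
  shows "(snd d \<circ> chart_inv c) differentiable (at (snd c x))"
proof -
  have "Ck_on (Suc 0) (snd c ` (fst c \<inter> fst d)) (snd d \<circ> chart_inv c)"
    using assms unfolding smooth_manifold_def smooth_on_def by blast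
  then show ?thesis
    using assms(4,5) by simp
qed

lemma transition_deriv_linear:
  assumes "smooth_manifold M A" "c \<in> A" "d \<in> A" "x \<in> fst c" "x \<in> fst d"
  shows "linear (transition_deriv c d x)"
  by (rule linear_frechet_derivative[OF transition_differentiable[OF assms]])

lemma transition_deriv_self:
  assumes "smooth_manifold M A" "c \<in> A" "x \<in> fst c"
  shows "transition_deriv c c x = id"
proof -
  have "transition_deriv c c x = frechet_derivative id (at (snd c x))"
  proof (rule frechet_derivative_transform_within_open)
    show "(snd c \<circ> chart_inv c) differentiable (at (snd c x))"
      using transition_differentiable[OF assms(1,2,2,3,3)] .
    show "open (snd c ` fst c)"
      using manifold_chart[OF assms(1,2)] by (simp add: is_chart_def)
    show "(snd c \<circ> chart_inv c) y = id y" if "y \<in> snd c ` fst c" for y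
      using that by (simp add: f_inv_into_f)
  qed (use assms in simp)
  then show ?thesis
    by (simp add: frechet_derivative_id id_def)
qed

text \<open>The chain rule; the two sides are derivatives of maps that agree only on the image of
  the overlap of \<open>c\<close> and \<open>d\<close>, an open set.\<close>

lemma transition_deriv_compose:
  assumes M: "smooth_manifold M A" and c: "c \<in> A" "x \<in> fst c"
    and d: "d \<in> A" "x \<in> fst d" and e: "e \<in> A" "x \<in> fst e"
  shows "transition_deriv d e x (transition_deriv c d x w) = transition_deriv c e x w"
proof -
  let ?p = "snd d \<circ> chart_inv c" and ?q = "snd e \<circ> chart_inv d"
  have p: "?p differentiable (at (snd c x))" and q: "?q differentiable (at (?p (snd c x)))"
    using transition_differentiable[OF M] c d e by (auto simp: chart_inv_chart[OF M])
  have "frechet_derivative (?q \<circ> ?p) (at (snd c x)) = transition_deriv c e x"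
  proof (rule frechet_derivative_transform_within_open)
    show "?q \<circ> ?p differentiable (at (snd c x))"
      by (rule differentiable_chain_at[OF p q])
    show "open (snd c ` (fst c \<inter> fst d))"
      using chart_overlap_open manifold_chart[OF M] c d by blast
    show "(?q \<circ> ?p) y = (snd e \<circ> chart_inv c) y" if "y \<in> snd c ` (fst c \<inter> fst d)" for y
      using that c d by (auto simp: chart_inv_chart[OF M])
  qed (use c d in simp)
  moreover have "frechet_derivative (?q \<circ> ?p) (at (snd c x)) =
      transition_deriv d e x \<circ> transition_deriv c d x"
    using frechet_derivative_compose[OF p q] unfolding comp_apply chart_inv_chart[OF M c] .
  ultimately show ?thesis
    by (metis comp_apply)
qed

text \<open>This and the next three lemmas identify \<open>T\<^sub>xM\<close> with \<open>\<real>\<^sup>n\<close> for each chart around \<open>x\<close>: the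
  linear map \<open>tangent_of\<close> is inverse to taking coordinates. The transformation law required of a
  tangent vector is the cocycle rule for derivatives of transition maps.\<close>

lemma tangent_of_mem:
  assumes "smooth_manifold M A" "c \<in> A" "x \<in> fst c"
  shows "tangent_of A c x w \<in> tangent_space A x"
  unfolding tangent_space_def
proof (intro CollectI conjI allI ballI impI)
  show "tangent_of A c x w d = 0" if "d \<notin> A \<or> x \<notin> fst d" for d
    using that by (auto simp: tangent_of_def)
  show "tangent_of A c x w e = transition_deriv d e x (tangent_of A c x w d)"
    if "d \<in> A" "e \<in> A" "x \<in> fst d \<inter> fst e" for d e
  proof -
    have d: "x \<in> fst d" and e: "x \<in> fst e"
      using that by auto
    show ?thesis
      using transition_deriv_compose[OF assms that(1) d that(2) e, of w] that(1,2) d e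
      by (simp only: tangent_of_def if_True simp_thms)
  qed
qed

lemma tangent_of_coord:
  assumes "smooth_manifold M A" "c \<in> A" "x \<in> fst c"
  shows "tangent_of A c x w c = w"
  using assms transition_deriv_self[OF assms] by (simp add: tangent_of_def)

lemma tangent_of_inverse:
  assumes "smooth_manifold M A" "c \<in> A" "x \<in> fst c" "v \<in> tangent_space A x"
  shows "tangent_of A c x (v c) = v"
proof
  fix d
  show "tangent_of A c x (v c) d = v d"
  proof (cases "d \<in> A \<and> x \<in> fst d")
    case True
    then have "v d = transition_deriv c d x (v c)"
      using assms(2-4) unfolding tangent_space_def by blast
    then show ?thesis
      using True by (simp only: tangent_of_def if_True simp_thms)
  next
    case False
    then have "v d = 0"
      using assms(4) unfolding tangent_space_def by blast
    then show ?thesis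
      using False by (simp only: tangent_of_def if_False)
  qed
qed

lemma tangent_of_combination:
  assumes "smooth_manifold M A" "c \<in> A" "x \<in> fst c"
  shows "tangent_of A c x (a *\<^sub>R u + b *\<^sub>R w) = a *\<^sub>R tangent_of A c x u + b *\<^sub>R tangent_of A c x w"
  using transition_deriv_linear[OF assms(1,2) _ assms(3)]
  by (auto simp: tangent_of_def fun_eq_iff linear_add linear_scale)


section \<open>Symmetric forms in coordinates\<close>

text \<open>Symmetry extends from tangent vectors to all arguments, since both sides vanish elsewhere.\<close>

lemma sym_form_symmetric:
  assumes "t \<in> sym_forms A x"
  shows "t v w = t w v"
  using assms unfolding sym_forms_def
  by (cases "v \<in> tangent_space A x"; cases "w \<in> tangent_space A x") simp_all

lemma sym_form_linear:
  assumes M: "smooth_manifold M A" "c \<in> A" "x \<in> fst c" and t: "t \<in> sym_forms A x"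
    and w: "w \<in> tangent_space A x"
  shows "linear (\<lambda>u. t (tangent_of A c x u) w)"
proof -
  have *: "t (tangent_of A c x (a *\<^sub>R u + b *\<^sub>R v)) w =
      a * t (tangent_of A c x u) w + b * t (tangent_of A c x v) w" for a b u v
    using t w tangent_of_mem[OF M] unfolding tangent_of_combination[OF M] sym_forms_def by blast
  show ?thesis
  proof (rule linearI)
    show "t (tangent_of A c x (u + v)) w = t (tangent_of A c x u) w + t (tangent_of A c x v) w" for u v
      using *[of 1 u 1 v] by simp
    show "t (tangent_of A c x (a *\<^sub>R u)) w = a *\<^sub>R t (tangent_of A c x u) w" for a u
      using *[of a u 0 u] by simp
  qed
qed

lemma sym_form_coords:
  assumes M: "smooth_manifold M A" "c \<in> A" "x \<in> fst c" and t: "t \<in> sym_forms A x"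
  shows "t (tangent_of A c x u) (tangent_of A c x w) = u \<bullet> (form_matrix A c x t *v w)"
proof -
  let ?\<tau> = "tangent_of A c x"
  have expand: "t (?\<tau> u) w = (\<Sum>i\<in>UNIV. u $ i * t (?\<tau> (axis i 1)) w)"
    if "w \<in> tangent_space A x" for u w
  proof -
    have lin: "linear (\<lambda>u. t (?\<tau> u) w)"
      by (rule sym_form_linear[OF M t that])
    have "t (?\<tau> u) w = t (?\<tau> (\<Sum>i\<in>UNIV. (u $ i) *\<^sub>R axis i 1)) w"
      using basis_expansion[of u] by (simp add: scalar_mult_eq_scaleR)
    also have "\<dots> = (\<Sum>i\<in>UNIV. u $ i * t (?\<tau> (axis i 1)) w)"
      by (simp add: linear_sum[OF lin, unfolded o_def] linear_scale[OF lin])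
    finally show ?thesis .
  qed
  have "t (?\<tau> u) (?\<tau> w) = (\<Sum>i\<in>UNIV. u $ i * t (?\<tau> (axis i 1)) (?\<tau> w))"
    by (rule expand[OF tangent_of_mem[OF M]])
  also have "\<dots> = u \<bullet> (form_matrix A c x t *v w)"
    unfolding inner_vec_def
  proof (rule sum.cong[OF refl])
    fix i
    have "t (?\<tau> (axis i 1)) (?\<tau> w) = t (?\<tau> w) (?\<tau> (axis i 1))"
      by (rule sym_form_symmetric[OF t])
    also have "\<dots> = (\<Sum>j\<in>UNIV. w $ j * t (?\<tau> (axis j 1)) (?\<tau> (axis i 1)))"
      by (rule expand[OF tangent_of_mem[OF M]])
    also have "\<dots> = (form_matrix A c x t *v w) $ i"
      unfolding matrix_vector_mult_def form_matrix_def
      by (simp add: mult.commute sym_form_symmetric[OF t, of "?\<tau> (axis i 1)"])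
    finally show "u $ i * t (?\<tau> (axis i 1)) (?\<tau> w) = u $ i \<bullet> (form_matrix A c x t *v w) $ i"
      by simp
  qed
  finally show ?thesis .
qed

lemma sym_form_eq_coords:
  assumes M: "smooth_manifold M A" "c \<in> A" "x \<in> fst c" and t: "t \<in> sym_forms A x"
    and "v \<in> tangent_space A x" "w \<in> tangent_space A x"
  shows "t v w = v c \<bullet> (form_matrix A c x t *v w c)"
  using sym_form_coords[OF M t, of "v c" "w c"]
  unfolding tangent_of_inverse[OF M assms(5)] tangent_of_inverse[OF M assms(6)] .

lemma transpose_form_matrix:
  assumes "t \<in> sym_forms A x"
  shows "transpose (form_matrix A c x t) = form_matrix A c x t"
proof -
  have "transpose (form_matrix A c x t) $ i $ j = form_matrix A c x t $ i $ j" for i j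
    using sym_form_symmetric[OF assms] by (simp add: transpose_def form_matrix_def)
  then show ?thesis
    by (simp add: vec_eq_iff)
qed

definition inner_products :: "('a, 'n::finite) chart set \<Rightarrow> 'a \<Rightarrow> ('a, 'n) form set" where
  "inner_products A x = {t \<in> sym_forms A x. \<forall>v\<in>tangent_space A x. v \<noteq> 0 \<longrightarrow> t v v > 0}"

definition orthonormal_basis ::
  "('a, 'n::finite) chart set \<Rightarrow> 'a \<Rightarrow> ('a, 'n) form \<Rightarrow> ('n \<Rightarrow> ('a, 'n) tangent) \<Rightarrow> bool" where
  "orthonormal_basis A x t e \<longleftrightarrow> (\<forall>i. e i \<in> tangent_space A x) \<and>
     (\<forall>i j. t (e i) (e j) = (if i = j then 1 else 0))"

lemma inner_product_sym_form: "t \<in> inner_products A x \<Longrightarrow> t \<in> sym_forms A x"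
  by (simp add: inner_products_def)

lemma positive_definite_form_matrix:
  fixes A :: "('a, 'n::finite) chart set"
  assumes M: "smooth_manifold M A" "c \<in> A" "x \<in> fst c" and t: "t \<in> inner_products A x"
  shows "positive_definite (form_matrix A c x t)"
  unfolding positive_definite_def
proof (intro conjI allI impI)
  have s: "t \<in> sym_forms A x"
    by (rule inner_product_sym_form[OF t])
  show "transpose (form_matrix A c x t) = form_matrix A c x t"
    by (rule transpose_form_matrix[OF s])
  fix u :: "real ^ 'n" assume "u \<noteq> 0"
  then have "tangent_of A c x u \<noteq> 0"
    using tangent_of_coord[OF M, of u] by auto
  then show "u \<bullet> (form_matrix A c x t *v u) > 0"
    using t tangent_of_mem[OF M, of u] unfolding sym_form_coords[OF M s, symmetric]
    by (simp add: inner_products_def)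
qed

lemma orthonormal_basis_coords:
  assumes M: "smooth_manifold M A" "c \<in> A" "x \<in> fst c" and t: "t \<in> sym_forms A x"
    and e: "orthonormal_basis A x t e"
  shows "matrix_orthonormal (form_matrix A c x t) (\<lambda>i. e i c)"
  unfolding matrix_orthonormal_def
proof (intro allI)
  fix i j
  have "e i \<in> tangent_space A x" "e j \<in> tangent_space A x" "t (e i) (e j) = (if i = j then 1 else 0)"
    using e by (auto simp: orthonormal_basis_def)
  then show "e i c \<bullet> (form_matrix A c x t *v e j c) = (if i = j then 1 else 0)"
    by (simp only: sym_form_eq_coords[OF M t])
qed

text \<open>Inverting \<open>g : T\<^sub>xM \<rightarrow> T\<^sub>x\<^sup>*M\<close> on the covector \<open>t v\<close> amounts to solving \<open>Gu = Tv\<close> in coordinates.\<close>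

lemma sharp_form:
  assumes M: "smooth_manifold M A" "c \<in> A" "x \<in> fst c"
    and g: "g \<in> inner_products A x" and t: "t \<in> sym_forms A x"
    and v: "v \<in> tangent_space A x"
  shows "sharp A x g (t v) =
    tangent_of A c x (matrix_inv (form_matrix A c x g) *v (form_matrix A c x t *v v c))"
    (is "_ = ?u")
proof -
  let ?G = "form_matrix A c x g" and ?T = "form_matrix A c x t"
  note gs = inner_product_sym_form[OF g]
  note posG = positive_definite_form_matrix[OF M g]
  have u: "?u \<in> tangent_space A x"
    by (rule tangent_of_mem[OF M])
  have swap: "s a b = b c \<bullet> (form_matrix A c x s *v a c)"
    if "s \<in> sym_forms A x" "a \<in> tangent_space A x" "b \<in> tangent_space A x" for s a b
    using sym_form_eq_coords[OF M that(1,3,2)]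
    unfolding sym_form_symmetric[OF that(1), of b a] .
  \<comment> \<open>The vector \<open>?u\<close> solves \<open>g u = t v\<close>. As forms vanish outside the tangent space, both sides agree on
    all arguments, as an equation of functions requires.\<close>
  have "g ?u = t v"
  proof
    fix w
    show "g ?u w = t v w"
    proof (cases "w \<in> tangent_space A x")
      case True
      have "g ?u w = w c \<bullet> (?G *v ?u c)"
        by (rule swap[OF gs u True])
      also have "\<dots> = w c \<bullet> (?T *v v c)"
        unfolding tangent_of_coord[OF M]
          matrix_vector_mult_matrix_inv[OF invertible_positive_definite[OF posG]] ..
      also have "\<dots> = t v w"
        by (rule swap[OF t v True, symmetric])
      finally show ?thesis .
    next
      case False
      then show ?thesis using gs t by (simp add: sym_forms_def)
    qed
  qed
  moreover have "inj_on g (tangent_space A x)"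
  proof (rule inj_onI)
    fix a b assume a: "a \<in> tangent_space A x" and b: "b \<in> tangent_space A x" and eq: "g a = g b"
    let ?w = "a c - b c"
    let ?\<tau> = "tangent_of A c x"
    \<comment> \<open>Test \<open>g a = g b\<close> against \<open>a - b\<close> itself.\<close>
    have "?w \<bullet> (?G *v ?w) = a c \<bullet> (?G *v ?w) - b c \<bullet> (?G *v ?w)"
      by (simp add: inner_diff_left)
    also have "\<dots> = g a (?\<tau> ?w) - g b (?\<tau> ?w)"
      using sym_form_eq_coords[OF M gs _ tangent_of_mem[OF M]] a b
      by (simp add: tangent_of_coord[OF M])
    finally have "?w = 0"
      using posG eq unfolding positive_definite_def by (metis diff_self less_irrefl)
    then have ab: "a c = b c"
      by simp
    show "a = b"
      using tangent_of_inverse[OF M a] unfolding ab tangent_of_inverse[OF M b] by (rule sym)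
  qed
  ultimately show ?thesis
    using u unfolding sharp_def by (intro inv_into_f_eq)
qed


section \<open>The trace in charts and in orthonormal bases\<close>

text \<open>The quantity \<open>trace (G\<^sup>-\<^sup>1HG\<^sup>-\<^sup>1K)\<close> for the matrices of \<open>g\<close>, \<open>h\<close>, \<open>k\<close> in the chart \<open>c\<close>. In this form it is
  visibly continuous in \<open>x\<close>, but its independence of \<open>c\<close> is not visible.\<close>

abbreviation coord_trace ::
  "('a, 'n::finite) chart set \<Rightarrow> ('a, 'n) chart \<Rightarrow> ('a \<Rightarrow> ('a, 'n) form) \<Rightarrow>
    ('a \<Rightarrow> ('a, 'n) form) \<Rightarrow> ('a \<Rightarrow> ('a, 'n) form) \<Rightarrow> 'a \<Rightarrow> real" where
  "coord_trace A c g h k x \<equiv>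
    trace (matrix_inv (form_matrix A c x (g x)) **
      (form_matrix A c x (h x) ** (matrix_inv (form_matrix A c x (g x)) ** form_matrix A c x (k x))))"

lemma metric_trace_coords_chart_at:
  assumes M: "smooth_manifold M A" and x: "x \<in> topspace M"
    and g: "g x \<in> inner_products A x" and h: "h x \<in> sym_forms A x" and k: "k x \<in> sym_forms A x"
  defines "c \<equiv> chart_at A x"
  shows "metric_trace A g h k x = coord_trace A c g h k x"
    (is "_ = trace ?B")
proof -
  have c: "c \<in> A" "x \<in> fst c"
    using chart_at_mem[OF M x] by (simp_all add: c_def)
  note Mc = M c
  have sh: "sharp A x (g x) (t v) =
      tangent_of A c x (matrix_inv (form_matrix A c x (g x)) *v (form_matrix A c x t *v v c))"
    if "t \<in> sym_forms A x" "v \<in> tangent_space A x" for t v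
    using sharp_form[OF Mc g that(1,2)] .
  have "(sharp A x (g x) \<circ> h x \<circ> sharp A x (g x) \<circ> k x) (tangent_of A c x w) c = ?B *v w" for w
    by (simp add: sh h k tangent_of_mem[OF Mc] tangent_of_coord[OF Mc] matrix_vector_mul_assoc
        matrix_mul_assoc)
  then show ?thesis
    unfolding metric_trace_def endo_trace_def Let_def c_def[symmetric] by (simp add: matrix_of_matrix_vector_mul)
qed

text \<open>With \<open>B = HG\<^sup>-\<^sup>1K\<close>, the right-hand side is \<open>trace (G\<^sup>-\<^sup>1B)\<close>, the sum of the values of \<open>B\<close> on the
  diagonal of the basis, and \<open>G\<^sup>-\<^sup>1K e\<^sub>i\<close> is the coordinate vector of \<open>(k e\<^sub>i)\<^sup>\<sharp>\<close>.\<close>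

lemma frame_sum_coords:
  assumes M: "smooth_manifold M A" "c \<in> A" "x \<in> fst c"
    and g: "g x \<in> inner_products A x" and h: "h x \<in> sym_forms A x" and k: "k x \<in> sym_forms A x"
    and E: "orthonormal_basis A x (g x) (\<lambda>i. E i x)"
  shows "frame_sum A g h k E x = coord_trace A c g h k x"
    (is "_ = trace (matrix_inv ?G ** (?H ** (matrix_inv ?G ** ?K)))")
proof -
  have E': "E i x \<in> tangent_space A x" for i
    using E by (simp add: orthonormal_basis_def)
  have "trace (matrix_inv ?G ** (?H ** (matrix_inv ?G ** ?K))) =
      (\<Sum>i\<in>UNIV. E i x c \<bullet> ((?H ** (matrix_inv ?G ** ?K)) *v E i x c))"
    by (rule trace_matrix_inv_orthonormal_basis[OF
          orthonormal_basis_coords[OF M inner_product_sym_form[OF g] E]])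
  also have "\<dots> = (\<Sum>i\<in>UNIV. h x (E i x) (sharp A x (g x) (k x (E i x))))"
    by (rule sum.cong[OF refl])
      (simp add: sharp_form[OF M g k E'] sym_form_eq_coords[OF M h E' tangent_of_mem[OF M]]
        tangent_of_coord[OF M] matrix_vector_mul_assoc matrix_mul_assoc)
  also have "\<dots> = frame_sum A g h k E x"
    unfolding frame_sum_def using sym_form_symmetric[OF h] by metis
  finally show ?thesis ..
qed

lemma exists_orthonormal_basis:
  assumes M: "smooth_manifold M A" "c \<in> A" "x \<in> fst c" and g: "g \<in> inner_products A x"
  obtains e where "orthonormal_basis A x g e"
proof -
  obtain b where b: "matrix_orthonormal (form_matrix A c x g) b"
    using exists_matrix_orthonormal[OF positive_definite_form_matrix[OF M g]] .
  have "orthonormal_basis A x g (\<lambda>i. tangent_of A c x (b i))"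
    using b tangent_of_mem[OF M]
    unfolding orthonormal_basis_def matrix_orthonormal_def
      sym_form_coords[OF M inner_product_sym_form[OF g]] by blast
  then show ?thesis
    by (rule that)
qed

lemma metric_trace_eq_frame_sum:
  assumes M: "smooth_manifold M A" and x: "x \<in> topspace M"
    and g: "g x \<in> inner_products A x" and h: "h x \<in> sym_forms A x" and k: "k x \<in> sym_forms A x"
    and E: "orthonormal_basis A x (g x) (\<lambda>i. E i x)"
  shows "metric_trace A g h k x = frame_sum A g h k E x"
  unfolding metric_trace_coords_chart_at[of M A x g h k, OF M x g h k]
    frame_sum_coords[of M A "chart_at A x" x g h k E, OF M chart_at_mem[OF M x] g h k E] ..

text \<open>Independence of the chart: compare the chart chosen in the definition of the trace with \<open>c\<close>
  through the frame sum of one orthonormal basis.\<close>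

lemma metric_trace_coords:
  assumes M: "smooth_manifold M A" "c \<in> A" "x \<in> fst c" and x: "x \<in> topspace M"
    and g: "g x \<in> inner_products A x" and h: "h x \<in> sym_forms A x" and k: "k x \<in> sym_forms A x"
  shows "metric_trace A g h k x = coord_trace A c g h k x"
proof -
  obtain e where e: "orthonormal_basis A x (g x) e"
    using exists_orthonormal_basis[OF M g] .
  show ?thesis
    unfolding metric_trace_eq_frame_sum[of M A x g h k "\<lambda>i _. e i", OF M(1) x g h k e]
    by (rule frame_sum_coords[where g = g and h = h and k = k and E = "\<lambda>i _. e i", OF M g h k e])
qed


section \<open>Boundedness and continuity of the integrand\<close>

lemma form_bound_orthonormal:
  assumes M: "smooth_manifold M A" "c \<in> A" "x \<in> fst c"
    and g: "g \<in> sym_forms A x" and h: "h \<in> sym_forms A x"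
    and le: "\<forall>v\<in>tangent_space A x. \<bar>h v v\<bar> \<le> l * g v v"
    and v: "v \<in> tangent_space A x" "g v v = 1" and w: "w \<in> tangent_space A x" "g w w = 1"
  shows "\<bar>h v w\<bar> \<le> l"
  unfolding sym_form_eq_coords[OF M h v(1) w(1)]
proof (rule polarization_bound[OF transpose_form_matrix[OF h]])
  show "\<bar>u \<bullet> (form_matrix A c x h *v u)\<bar> \<le> l * (u \<bullet> (form_matrix A c x g *v u))" for u
    using bspec[OF le tangent_of_mem[OF M], of u] unfolding sym_form_coords[OF M h] sym_form_coords[OF M g] .
  show "v c \<bullet> (form_matrix A c x g *v v c) = 1"
    using sym_form_eq_coords[OF M g v(1) v(1)] v(2) by linarith
  show "w c \<bullet> (form_matrix A c x g *v w c) = 1"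
    using sym_form_eq_coords[OF M g w(1) w(1)] w(2) by linarith
qed

text \<open>Expand \<open>(k e\<^sub>i)\<^sup>\<sharp> = \<Sum>\<^sub>j k(e\<^sub>i, e\<^sub>j) e\<^sub>j\<close>. The summands now involve only values of \<open>h\<close> and \<open>k\<close> on
  vectors of unit length, which is what the estimate needs.\<close>

lemma frame_sum_expand:
  fixes A :: "('a, 'n::finite) chart set"
  assumes M: "smooth_manifold M A" "c \<in> A" "x \<in> fst c"
    and g: "g x \<in> inner_products A x" and h: "h x \<in> sym_forms A x" and k: "k x \<in> sym_forms A x"
    and E: "orthonormal_basis A x (g x) (\<lambda>i. E i x)"
  shows "frame_sum A g h k E x =
    (\<Sum>i\<in>UNIV. \<Sum>j\<in>UNIV. h x (E i x) (E j x) * k x (E i x) (E j x))"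
  unfolding frame_sum_def
proof (rule sum.cong[OF refl])
  fix i
  let ?G = "form_matrix A c x (g x)" and ?H = "form_matrix A c x (h x)" and ?K = "form_matrix A c x (k x)"
  let ?e = "\<lambda>j. E j x c"
  have E': "E i x \<in> tangent_space A x" for i
    using E by (simp add: orthonormal_basis_def)
  have hk: "?e i \<bullet> (?H *v ?e j) = h x (E i x) (E j x)" "?e j \<bullet> (?K *v ?e i) = k x (E i x) (E j x)" for j
    using sym_form_eq_coords[OF M h E' E'] sym_form_eq_coords[OF M k E' E'] sym_form_symmetric[OF k]
    by metis+
  have "h x (sharp A x (g x) (k x (E i x))) (E i x) = h x (E i x) (sharp A x (g x) (k x (E i x)))"
    by (rule sym_form_symmetric[OF h])
  also have "\<dots> = ?e i \<bullet> (?H *v (matrix_inv ?G *v (?K *v ?e i)))"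
    unfolding sharp_form[OF M g k E'] sym_form_eq_coords[OF M h E' tangent_of_mem[OF M]]
      tangent_of_coord[OF M] ..
  also have "\<dots> = ?e i \<bullet> (?H *v (\<Sum>j\<in>UNIV. (?e j \<bullet> (?K *v ?e i)) *\<^sub>R ?e j))"
    unfolding matrix_inv_vector_orthonormal_basis[OF
        orthonormal_basis_coords[OF M inner_product_sym_form[OF g] E]] ..
  also have "\<dots> = (\<Sum>j\<in>UNIV. (?e j \<bullet> (?K *v ?e i)) * (?e i \<bullet> (?H *v ?e j)))"
    by (simp add: linear_sum[OF matrix_vector_mul_linear] inner_sum_right matrix_vector_mult_scaleR)
  also have "\<dots> = (\<Sum>j\<in>UNIV. h x (E i x) (E j x) * k x (E i x) (E j x))"
    by (simp add: hk mult.commute)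
  finally show "h x (sharp A x (g x) (k x (E i x))) (E i x) =
    (\<Sum>j\<in>UNIV. h x (E i x) (E j x) * k x (E i x) (E j x))" .
qed

lemma metric_trace_bound:
  fixes A :: "('a, 'n::finite) chart set"
  assumes M: "smooth_manifold M A" and x: "x \<in> topspace M"
    and g: "g x \<in> inner_products A x" and h: "h x \<in> sym_forms A x" and k: "k x \<in> sym_forms A x"
    and lh: "\<forall>v\<in>tangent_space A x. \<bar>h x v v\<bar> \<le> l * g x v v"
    and lk: "\<forall>v\<in>tangent_space A x. \<bar>k x v v\<bar> \<le> m * g x v v"
    and "l \<ge> 0"
  shows "\<bar>metric_trace A g h k x\<bar> \<le> (real CARD('n))\<^sup>2 * (l * m)"
proof -
  note c = M chart_at_mem[OF M x] and gs = inner_product_sym_form[OF g]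
  obtain e where e: "orthonormal_basis A x (g x) e"
    using exists_orthonormal_basis[OF c g] .
  then have e': "e i \<in> tangent_space A x" "g x (e i) (e i) = 1" for i
    by (auto simp: orthonormal_basis_def)
  have b: "\<bar>h x (e i) (e j) * k x (e i) (e j)\<bar> \<le> l * m" for i j
    unfolding abs_mult
    by (intro mult_mono form_bound_orthonormal[OF c gs h lh] form_bound_orthonormal[OF c gs k lk])
      (use e' \<open>l \<ge> 0\<close> in auto)
  have "metric_trace A g h k x = (\<Sum>i\<in>UNIV. \<Sum>j\<in>UNIV. h x (e i) (e j) * k x (e i) (e j))"
    unfolding metric_trace_eq_frame_sum[of M A x g h k "\<lambda>i _. e i", OF M x g h k e]
    by (rule frame_sum_expand[where g = g and h = h and k = k and E = "\<lambda>i _. e i", OF c g h k e])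
  also have "\<bar>\<dots>\<bar> \<le> (\<Sum>i\<in>(UNIV :: 'n set). \<Sum>j\<in>(UNIV :: 'n set). l * m)"
    by (intro order_trans[OF sum_abs] sum_mono b)
  also have "\<dots> = (real CARD('n))\<^sup>2 * (l * m)"
    by (simp add: power2_eq_square)
  finally show ?thesis .
qed

text \<open>The component of a jet in degree zero is the section itself, and membership of that component in
  the jet cone is positive semidefiniteness.\<close>

lemma indef_measurable_section_bound:
  assumes "s \<in> indef_measurable_sections M A nT nE KT g"
  obtains l where "l \<ge> 0"
    "\<And>x. x \<in> topspace M \<Longrightarrow> \<forall>v\<in>tangent_space A x. \<bar>s x v v\<bar> \<le> l * g x v v"
proof -
  obtain l where l: "l \<ge> 0"
      "jet_le M A KT 0 ((- l) *\<^sub>R jet M A nT nE 0 g) (jet M A nT nE 0 s)"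
      "jet_le M A KT 0 (jet M A nT nE 0 s) (l *\<^sub>R jet M A nT nE 0 g)"
    using assms unfolding indef_measurable_sections_def by blast
  have jet: "jet M A nT nE 0 t x 0 [] = t x" for t x
    by (simp add: jet_def sym_covariant_derivs_def)
  have cone: "t 0 [] \<in> psd_cone A x" if "t \<in> jet_cone A KT 0 x" for t x
    using that by (simp add: jet_cone_def)
  show ?thesis
  proof (rule that[OF l(1)])
    fix x assume x: "x \<in> topspace M"
    have "s x - (- l) *\<^sub>R g x \<in> psd_cone A x" "l *\<^sub>R g x - s x \<in> psd_cone A x"
      using cone[of _ x] l(2,3) x unfolding jet_le_def by (force simp: jet)+
    then have "0 \<le> (s x - (- l) *\<^sub>R g x) v v" "0 \<le> (l *\<^sub>R g x - s x) v v"
      if "v \<in> tangent_space A x" for v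
      using that unfolding psd_cone_def by blast+
    then have "\<bar>s x v v\<bar> \<le> l * g x v v" if "v \<in> tangent_space A x" for v
      using that by (force simp: abs_le_iff)
    then show "\<forall>v\<in>tangent_space A x. \<bar>s x v v\<bar> \<le> l * g x v v"
      by blast
  qed
qed

lemma riemannian_metric_inner_product:
  assumes "g \<in> riemannian_metrics M A" "x \<in> topspace M"
  shows "g x \<in> inner_products A x"
  using assms by (auto simp: riemannian_metrics_def sym_tensor_fields_def inner_products_def)

lemma sym_tensor_field_coords_continuous:
  assumes "s \<in> sym_tensor_fields M A" "c \<in> A"
  shows "continuous_on (snd c ` fst c) (\<lambda>y. form_matrix A c (chart_inv c y) (s (chart_inv c y)))"
proof -
  have "Ck_on 0 (snd c ` fst c) (\<lambda>y. form_matrix A c (chart_inv c y) (s (chart_inv c y)))"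
    using assms unfolding sym_tensor_fields_def smooth_on_def by blast
  then show ?thesis by simp
qed

text \<open>Openness of preimages is checked on the domains of the charts. As these need not be countably
  many, the measurability of the integrand is obtained from its continuity and not by gluing
  functions measurable on each chart.\<close>

lemma metric_trace_continuous:
  fixes A :: "('a, 'n::finite) chart set"
  assumes M: "smooth_manifold M A" and g: "g \<in> riemannian_metrics M A"
    and h: "h \<in> sym_tensor_fields M A" and k: "k \<in> sym_tensor_fields M A"
  shows "continuous_map M euclidean (metric_trace A g h k)"
  unfolding continuous_map
proof (intro conjI allI impI)
  fix V :: "real set" assume V: "openin euclidean V"
  have union: "\<Union> (fst ` A) = topspace M"
    using M by (simp add: smooth_manifold_def)
  have loc: "openin M {x \<in> fst c. metric_trace A g h k x \<in> V}" if c: "c \<in> A" for c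
  proof -
    let ?S = "snd c ` fst c"
    let ?F = "\<lambda>s y. form_matrix A c (chart_inv c y) (s (chart_inv c y))"
    let ?\<phi> = "\<lambda>y. trace (matrix_inv (?F g y) ** (?F h y ** (matrix_inv (?F g y) ** ?F k y)))"
    have sub: "fst c \<subseteq> topspace M"
      using c union by blast
    have gs: "g \<in> sym_tensor_fields M A"
      using g by (simp add: riemannian_metrics_def)
    have inv: "invertible (?F g y)" if y: "y \<in> ?S" for y
    proof -
      have x: "chart_inv c y \<in> fst c"
        using y by (rule inv_into_into)
      show ?thesis
        using riemannian_metric_inner_product[OF g] sub x
        by (intro invertible_positive_definite positive_definite_form_matrix[OF M c x]) blast
    qed
    have "continuous_on ?S ?\<phi>"
      by (intro continuous_intros sym_tensor_field_coords_continuous[where M = M] gs h k c inv)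
    moreover have chart: "is_chart M c"
      by (rule manifold_chart[OF M c])
    ultimately have "openin (top_of_set ?S) {y \<in> ?S. ?\<phi> y \<in> V}"
      using V continuous_openin_preimage_gen[of ?S ?\<phi> V] by (simp add: vimage_def Int_def)
    moreover have "continuous_map (subtopology M (fst c)) (top_of_set ?S) (snd c)"
      using chart homeomorphic_imp_continuous_map unfolding is_chart_def by blast
    ultimately have "openin (subtopology M (fst c))
        {x \<in> topspace (subtopology M (fst c)). snd c x \<in> {y \<in> ?S. ?\<phi> y \<in> V}}"
      by (rule openin_continuous_map_preimage[rotated])
    also have "{x \<in> topspace (subtopology M (fst c)). snd c x \<in> {y \<in> ?S. ?\<phi> y \<in> V}} =
        {x \<in> fst c. metric_trace A g h k x \<in> V}"
    proof -
      have "metric_trace A g h k x = ?\<phi> (snd c x)" if x: "x \<in> fst c" for x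
      proof -
        have xM: "x \<in> topspace M"
          using x sub by blast
        then have hk: "h x \<in> sym_forms A x" "k x \<in> sym_forms A x"
          using h k by (auto simp: sym_tensor_fields_def)
        show ?thesis
          unfolding chart_inv_chart[OF M c x]
          by (rule metric_trace_coords[where g = g and h = h and k = k,
                OF M c x xM riemannian_metric_inner_product[OF g xM] hk])
      qed
      then show ?thesis
        using sub by auto
    qed
    finally show ?thesis
      using chart openin_trans_full unfolding is_chart_def by blast
  qed
  have "{x \<in> topspace M. metric_trace A g h k x \<in> V} =
      (\<Union>c\<in>A. {x \<in> fst c. metric_trace A g h k x \<in> V})"
    using union by blast
  then show "openin M {x \<in> topspace M. metric_trace A g h k x \<in> V}"
    using loc by auto
qed auto


section \<open>Integrability\<close>

lemma space_riemannian_volume: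
  assumes "smooth_manifold M A"
  shows "space (riemannian_volume M A g) = topspace M"
proof -
  have cover: "topspace M = \<Union> (fst ` A)"
    using assms by (simp add: smooth_manifold_def)
  have "space (chart_volume M A g c) = topspace M" for c
    by (simp add: chart_volume_def borel_of_topology_def space_measure_of_conv)
  then have "space (riemannian_volume M A g) = (\<Union>c\<in>A. topspace M)"
    by (simp add: riemannian_volume_def space_Sup_eq_UN)
  \<comment> \<open>If the atlas is empty, the supremum is the zero measure on the empty space, and \<open>M\<close> is empty too.\<close>
  also have "\<dots> = topspace M"
    using cover by blast
  finally show ?thesis .
qed

lemma sets_riemannian_volume:
  assumes "A \<noteq> {}"
  shows "sets (riemannian_volume M A g) = sets (borel_of_topology M)"
  unfolding riemannian_volume_def
  by (rule sets_SUP[OF _ assms]) (simp add: chart_volume_def)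

text \<open>For a nonempty atlas the volume lives on the Borel sets of \<open>M\<close>; for an empty one its space is
  empty.\<close>

lemma continuous_map_measurable_riemannian_volume:
  fixes f :: "'a \<Rightarrow> real"
  assumes f: "continuous_map M euclidean f"
  shows "f \<in> borel_measurable (riemannian_volume M A g)"
proof (cases "A = {}")
  case True
  then have "space (riemannian_volume M A g) = {}"
    by (simp add: riemannian_volume_def space_Sup_eq_UN)
  then show ?thesis
    by (simp add: measurable_def)
next
  case A: False
  have sub: "{U. openin M U} \<subseteq> Pow (topspace M)"
    using openin_subset by blast
  have "f \<in> borel_measurable (borel_of_topology M)"
  proof (rule borel_measurableI)
    fix S :: "real set" assume "open S"
    then have "openin M {x \<in> topspace M. f x \<in> S}"
      using f by (simp add: continuous_map_def)
    also have "{x \<in> topspace M. f x \<in> S} = f -` S \<inter> space (borel_of_topology M)"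
      using space_measure_of[OF sub] by (auto simp: borel_of_topology_def)
    finally show "f -` S \<inter> space (borel_of_topology M) \<in> sets (borel_of_topology M)"
      unfolding borel_of_topology_def by (intro in_measure_of[OF sub] CollectI)
  qed
  then show ?thesis
    using measurable_cong_sets[OF sets_riemannian_volume[OF A] refl] by blast
qed

lemma metric_trace_integrable:
  fixes A :: "('a, 'n::finite) chart set"
  assumes M: "smooth_manifold M A" and g: "g \<in> finite_volume_metrics M A"
    and h: "h \<in> indef_measurable_sections M A nT nE KT g"
    and k: "k \<in> indef_measurable_sections M A nT nE KT g"
  shows "integrable (riemannian_volume M A g) (metric_trace A g h k)"
proof -
  let ?\<nu> = "riemannian_volume M A g"
  have gr: "g \<in> riemannian_metrics M A"
    using g by (simp add: finite_volume_metrics_def)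
  have hs: "h \<in> sym_tensor_fields M A" and ks: "k \<in> sym_tensor_fields M A"
    using h k by (simp_all add: indef_measurable_sections_def)
  obtain l where l: "l \<ge> 0"
      "\<And>x. x \<in> topspace M \<Longrightarrow> \<forall>v\<in>tangent_space A x. \<bar>h x v v\<bar> \<le> l * g x v v"
    using indef_measurable_section_bound[OF h] by blast
  obtain m where m: "m \<ge> 0"
      "\<And>x. x \<in> topspace M \<Longrightarrow> \<forall>v\<in>tangent_space A x. \<bar>k x v v\<bar> \<le> m * g x v v"
    using indef_measurable_section_bound[OF k] by blast
  interpret finite_measure ?\<nu>
  proof
    show "emeasure ?\<nu> (space ?\<nu>) \<noteq> \<infinity>"
      using g by (simp add: finite_volume_metrics_def space_riemannian_volume[OF M] less_top)
  qed
  show ?thesis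
  proof (rule integrable_const_bound)
    show "metric_trace A g h k \<in> borel_measurable ?\<nu>"
      by (intro continuous_map_measurable_riemannian_volume metric_trace_continuous M gr hs ks)
    show "AE x in ?\<nu>. norm (metric_trace A g h k x) \<le> (real CARD('n))\<^sup>2 * (l * m)"
    proof (rule AE_I2)
      fix x assume "x \<in> space ?\<nu>"
      then have x: "x \<in> topspace M"
        by (simp add: space_riemannian_volume[OF M])
      have "h x \<in> sym_forms A x" "k x \<in> sym_forms A x"
        using hs ks x by (auto simp: sym_tensor_fields_def)
      from metric_trace_bound[of M A x g h k, OF M x riemannian_metric_inner_product[OF gr x] this
          l(2)[OF x] m(2)[OF x] l(1)]
      show "norm (metric_trace A g h k x) \<le> (real CARD('n))\<^sup>2 * (l * m)"
        by simp
    qed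
  qed
qed

theorem theorem3p2:
  fixes M :: "'a topology"
    and A :: "('a, 'n::finite) chart set"
    and KT :: "'a \<Rightarrow> ('a, 'n) tangent set"
    and nT :: "('a \<Rightarrow> ('a, 'n) tangent) \<Rightarrow> ('a \<Rightarrow> ('a, 'n) tangent) \<Rightarrow> ('a \<Rightarrow> ('a, 'n) tangent)"
    and nE :: "('a \<Rightarrow> ('a, 'n) tangent) \<Rightarrow> ('a \<Rightarrow> ('a, 'n) form) \<Rightarrow> ('a \<Rightarrow> ('a, 'n) form)"
    and g h k :: "'a \<Rightarrow> ('a, 'n) form"
  assumes "smooth_manifold M A"
    and "tangent_cone_field M A KT"
    and "connection M A (vector_fields M A) nT"
    and "connection M A (sym_tensor_fields M A) nE"
    and "g \<in> finite_volume_metrics M A"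
    and "h \<in> indef_measurable_sections M A nT nE KT g"
    and "k \<in> indef_measurable_sections M A nT nE KT g"
  shows "integrable (riemannian_volume M A g) (metric_trace A g h k)
    \<and> (\<forall>U E. local_orthonormal_frame M A g U E \<longrightarrow>
         (\<forall>x\<in>U. metric_trace A g h k x = frame_sum A g h k E x))
    \<and> (\<forall>E. (\<forall>x\<in>topspace M. \<exists>U F. local_orthonormal_frame M A g U F \<and> x \<in> U \<and> (\<forall>i. E i x = F i x)) \<longrightarrow>
         integrable (riemannian_volume M A g) (frame_sum A g h k E) \<and>
         L2_metric M A g h k = (LINT x|riemannian_volume M A g. frame_sum A g h k E x))"
proof -
  have int: "integrable (riemannian_volume M A g) (metric_trace A g h k)"
    by (rule metric_trace_integrable[OF assms(1,5-7)])
  have gr: "g \<in> riemannian_metrics M A"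
    using assms(5) by (simp add: finite_volume_metrics_def)
  have hk: "h x \<in> sym_forms A x" "k x \<in> sym_forms A x" if "x \<in> topspace M" for x
    using assms(6,7) that by (auto simp: indef_measurable_sections_def sym_tensor_fields_def)
  have frame: "metric_trace A g h k x = frame_sum A g h k E x"
    if E: "local_orthonormal_frame M A g U E" and xU: "x \<in> U" for U E x
  proof -
    have x: "x \<in> topspace M"
      using E xU openin_subset unfolding local_orthonormal_frame_def by blast
    have "orthonormal_basis A x (g x) (\<lambda>i. E i x)"
      using E xU unfolding local_orthonormal_frame_def smooth_field_on_def orthonormal_basis_def by blast
    then show ?thesis
      by (rule metric_trace_eq_frame_sum[of M A x g h k,
            OF assms(1) x riemannian_metric_inner_product[OF gr x] hk[OF x]])
  qed
  moreover have "integrable (riemannian_volume M A g) (frame_sum A g h k E) \<and>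
      L2_metric M A g h k = (LINT x|riemannian_volume M A g. frame_sum A g h k E x)"
    if E: "\<forall>x\<in>topspace M. \<exists>U F. local_orthonormal_frame M A g U F \<and> x \<in> U \<and> (\<forall>i. E i x = F i x)" for E
  proof -
    have eq: "metric_trace A g h k x = frame_sum A g h k E x"
      if x: "x \<in> space (riemannian_volume M A g)" for x
    proof -
      obtain U F where "local_orthonormal_frame M A g U F" "x \<in> U" "\<And>i. E i x = F i x"
        using E x unfolding space_riemannian_volume[OF assms(1)] by blast
      then show ?thesis
        using frame by (simp add: frame_sum_def)
    qed
    show ?thesis
      using int unfolding L2_metric_def
      by (simp add: eq cong: Bochner_Integration.integrable_cong Bochner_Integration.integral_cong)
  qed
  ultimately show ?thesis
    using int by blast
qed

end
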